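(* Let $G$ be a finite groupoid which has a nonidentity morphism. Then there is a ring, strongly graded by $G$, which is not a crossed product over $G$.
   Context: All rings are associative and unital, with nonzero identity; ring homomorphisms respect identities. For a category $G$, an object is identified with its identity morphism, $s\in G$ means that $s$ is a morphism, $d(s)$ and $c(s)$ are the domain and codomain of $s$, and $G^{(2)}$ is the set of pairs $(s,t)$ of morphisms with $d(s)=c(t)$ (with composite $st$). A groupoid is a category in which all morphisms are invertible. A ring $R$ is graded by $G$ if there are additive subgroups $R_s$, $s\in G$, of $R$ with $R=\bigoplus_{s\in G}R_s$ and, for all $s,t\in G$, $R_sR_t\subseteq R_{st}$ if $(s,t)\in G^{(2)}$ and $R_sR_t=\{0\}$ otherwise. It is strongly graded by $G$ if moreover $R_sR_t=R_{st}$ for all $(s,t)\in G^{(2)}$ (here $R_sR_t$ is the additive group generated by the products). Crossed products over $G$: a crossed system is a quadruple $\{A,G,\sigma,\alpha\}$ where $A$ is the direct sum of rings $A_e$, $e\in\mathrm{ob}(G)$, $\sigma_s:A_{d(s)}\to A_{c(s)}$, $s\in G$, are ring homomorphisms, and $\alpha$ is a map assigning to each $(s,t)\in G^{(2)}$ an element $\alpha(s,t)\in A_{c(s)}$, such that $\sigma_e=\mathrm{id}_{A_e}$ for $e\in\mathrm{ob}(G)$; $\alpha(s,d(s))=1_{A_{c(s)}}$ and $\alpha(c(s),s)=1_{A_{c(s)}}$ for $s\in G$; $\alpha(s,t)\alpha(st,r)=\sigma_s(\alpha(t,r))\alpha(s,tr)$ for all $(s,t),(t,r)\in G^{(2)}$;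 and $\sigma_s(\sigma_t(a))\alpha(s,t)=\alpha(s,t)\sigma_{st}(a)$ for all $(s,t)\in G^{(2)}$, $a\in A_{d(t)}$. The associated crossed product $A\rtimes^{\sigma}_{\alpha}G$ is the set of formal sums $\sum_{s\in G}a_su_s$ with $a_s\in A_{c(s)}$, all but finitely many zero, with pointwise addition and multiplication the bilinear extension of $(a_su_s)(b_tu_t)=a_s\sigma_s(b_t)\alpha(s,t)u_{st}$ if $(s,t)\in G^{(2)}$ and $(a_su_s)(b_tu_t)=0$ otherwise. It is graded by $G$ with components $(A\rtimes^{\sigma}_{\alpha}G)_s=A_{c(s)}u_s$. A ring $R$ graded by $G$ is a crossed product over $G$ if it is isomorphic, as a $G$-graded ring (by a ring isomorphism mapping the component of degree $s$ onto the component of degree $s$ for every $s\in G$), to some $A\rtimes^{\sigma}_{\alpha}G$ of this form. *)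

theory Defs
  imports "HOL-Algebra.Algebra"
begin

section \<open>Categories and groupoids\<close>

text \<open>Arrows-only presentation: an object is identified with its identity morphism.\<close>

record 'm category =
  Mor :: "'m set"
  Dom :: "'m \<Rightarrow> 'm" (\<open>\<d>\<index>\<close>)
  Cod :: "'m \<Rightarrow> 'm" (\<open>\<c>\<index>\<close>)
  Comp :: "'m \<Rightarrow> 'm \<Rightarrow> 'm" (infixl \<open>\<bullet>\<index>\<close> 70)

definition Obj :: "('m, 'x) category_scheme \<Rightarrow> 'm set" where
  "Obj G = {e \<in> Mor G. \<d>\<^bsub>G\<^esub> e = e}"

definition composable :: "('m, 'x) category_scheme \<Rightarrow> ('m \<times> 'm) set" where
  "composable G = {(s, t). s \<in> Mor G \<and> t \<in> Mor G \<and> \<d>\<^bsub>G\<^esub> s = \<c>\<^bsub>G\<^esub> t}"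

locale category =
  fixes G :: "('m, 'x) category_scheme" (structure)
  assumes dom_closed: "s \<in> Mor G \<Longrightarrow> \<d> s \<in> Mor G"
    and cod_closed: "s \<in> Mor G \<Longrightarrow> \<c> s \<in> Mor G"
    and dom_dom: "s \<in> Mor G \<Longrightarrow> \<d> (\<d> s) = \<d> s"
    and cod_dom: "s \<in> Mor G \<Longrightarrow> \<c> (\<d> s) = \<d> s"
    and dom_cod: "s \<in> Mor G \<Longrightarrow> \<d> (\<c> s) = \<c> s"
    and cod_cod: "s \<in> Mor G \<Longrightarrow> \<c> (\<c> s) = \<c> s"
    and comp_closed: "(s, t) \<in> composable G \<Longrightarrow> s \<bullet> t \<in> Mor G"
    and dom_comp: "(s, t) \<in> composable G \<Longrightarrow> \<d> (s \<bullet> t) = \<d> t"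
    and cod_comp: "(s, t) \<in> composable G \<Longrightarrow> \<c> (s \<bullet> t) = \<c> s"
    and comp_assoc: "\<lbrakk>(s, t) \<in> composable G; (t, r) \<in> composable G\<rbrakk> \<Longrightarrow> (s \<bullet> t) \<bullet> r = s \<bullet> (t \<bullet> r)"
    and comp_dom: "s \<in> Mor G \<Longrightarrow> s \<bullet> \<d> s = s"
    and cod_comp_self: "s \<in> Mor G \<Longrightarrow> \<c> s \<bullet> s = s"

locale groupoid = category +
  assumes invertible: "s \<in> Mor G \<Longrightarrow>
    \<exists>t \<in> Mor G. \<d> t = \<c> s \<and> \<c> t = \<d> s \<and> s \<bullet> t = \<c> s \<and> t \<bullet> s = \<d> s"

section \<open>Graded rings\<close>

definition add_span_mult :: "('r, 'y) ring_scheme \<Rightarrow> 'r set \<Rightarrow> 'r set \<Rightarrow> 'r set" where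
  "add_span_mult R H K = generate (add_monoid R) (H <#>\<^bsub>R\<^esub> K)"

locale nonzero_ring = ring +
  assumes one_neq_zero: "\<one> \<noteq> \<zero>"

locale graded_ring = G: category G + R: nonzero_ring R
  for G :: "('m, 'x) category_scheme" and R :: "('r, 'y) ring_scheme" and gr :: "'m \<Rightarrow> 'r set" +
  assumes gr_subgroup: "s \<in> Mor G \<Longrightarrow> additive_subgroup (gr s) R"
    and direct_sum: "x \<in> carrier R \<Longrightarrow>
      \<exists>!f. f \<in> (\<Pi>\<^sub>E s\<in>Mor G. gr s) \<and> finite {s \<in> Mor G. f s \<noteq> \<zero>\<^bsub>R\<^esub>} \<and>
           x = (\<Oplus>\<^bsub>R\<^esub>s \<in> {s \<in> Mor G. f s \<noteq> \<zero>\<^bsub>R\<^esub>}. f s)"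
    and gr_mult: "(s, t) \<in> composable G \<Longrightarrow>
      add_span_mult R (gr s) (gr t) \<subseteq> gr (s \<bullet>\<^bsub>G\<^esub> t)"
    and gr_mult_zero: "\<lbrakk>s \<in> Mor G; t \<in> Mor G; (s, t) \<notin> composable G\<rbrakk> \<Longrightarrow>
      add_span_mult R (gr s) (gr t) = {\<zero>\<^bsub>R\<^esub>}"

locale strongly_graded_ring = graded_ring +
  assumes gr_mult_eq: "(s, t) \<in> composable G \<Longrightarrow>
      add_span_mult R (gr s) (gr t) = gr (s \<bullet>\<^bsub>G\<^esub> t)"

section \<open>Crossed products\<close>

text \<open>The ring \<open>A\<close>, a direct sum of rings, is represented by the family of its summands
  \<open>A e\<close>, indexed by the objects \<open>e\<close>. The elements \<open>\<alpha> s t\<close> are not required to be units.\<close>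

locale crossed_system = category G
  for G :: "('m, 'x) category_scheme" (structure)
    and A :: "'m \<Rightarrow> 'a ring" and \<sigma> :: "'m \<Rightarrow> 'a \<Rightarrow> 'a" and \<alpha> :: "'m \<Rightarrow> 'm \<Rightarrow> 'a" +
  assumes ring_A: "e \<in> Obj G \<Longrightarrow> nonzero_ring (A e)"
    and \<sigma>_hom: "s \<in> Mor G \<Longrightarrow> \<sigma> s \<in> ring_hom (A (\<d> s)) (A (\<c> s))"
    and \<alpha>_closed: "(s, t) \<in> composable G \<Longrightarrow> \<alpha> s t \<in> carrier (A (\<c> s))"
    and \<sigma>_id: "\<lbrakk>e \<in> Obj G; a \<in> carrier (A e)\<rbrakk> \<Longrightarrow> \<sigma> e a = a"
    and \<alpha>_dom: "s \<in> Mor G \<Longrightarrow> \<alpha> s (\<d> s) = \<one>\<^bsub>A (\<c> s)\<^esub>"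
    and \<alpha>_cod: "s \<in> Mor G \<Longrightarrow> \<alpha> (\<c> s) s = \<one>\<^bsub>A (\<c> s)\<^esub>"
    and cocycle: "\<lbrakk>(s, t) \<in> composable G; (t, r) \<in> composable G\<rbrakk> \<Longrightarrow>
      \<alpha> s t \<otimes>\<^bsub>A (\<c> s)\<^esub> \<alpha> (s \<bullet> t) r = \<sigma> s (\<alpha> t r) \<otimes>\<^bsub>A (\<c> s)\<^esub> \<alpha> s (t \<bullet> r)"
    and twisted_action: "\<lbrakk>(s, t) \<in> composable G; a \<in> carrier (A (\<d> t))\<rbrakk> \<Longrightarrow>
      \<sigma> s (\<sigma> t a) \<otimes>\<^bsub>A (\<c> s)\<^esub> \<alpha> s t = \<alpha> s t \<otimes>\<^bsub>A (\<c> s)\<^esub> \<sigma> (s \<bullet> t) a"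

text \<open>The formal sum of the \<open>a\<^sub>s u\<^sub>s\<close> is the extensional function \<open>s \<mapsto> a\<^sub>s\<close>. If there are
  infinitely many objects, the field \<open>one\<close> is not in the carrier (the ring has no identity).\<close>

definition crossed_product ::
  "('m, 'x) category_scheme \<Rightarrow> ('m \<Rightarrow> 'a ring) \<Rightarrow> ('m \<Rightarrow> 'a \<Rightarrow> 'a) \<Rightarrow> ('m \<Rightarrow> 'm \<Rightarrow> 'a) \<Rightarrow> ('m \<Rightarrow> 'a) ring"
where
  "crossed_product G A \<sigma> \<alpha> =
    \<lparr> carrier = {f \<in> (\<Pi>\<^sub>E s\<in>Mor G. carrier (A (\<c>\<^bsub>G\<^esub> s))). finite {s \<in> Mor G. f s \<noteq> \<zero>\<^bsub>A (\<c>\<^bsub>G\<^esub> s)\<^esub>}},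
      monoid.mult = (\<lambda>f g. \<lambda>r\<in>Mor G.
        finsum (A (\<c>\<^bsub>G\<^esub> r))
          (\<lambda>(s, t). f s \<otimes>\<^bsub>A (\<c>\<^bsub>G\<^esub> r)\<^esub> \<sigma> s (g t) \<otimes>\<^bsub>A (\<c>\<^bsub>G\<^esub> r)\<^esub> \<alpha> s t)
          {(s, t) \<in> composable G. s \<bullet>\<^bsub>G\<^esub> t = r \<and>
             f s \<noteq> \<zero>\<^bsub>A (\<c>\<^bsub>G\<^esub> s)\<^esub> \<and> g t \<noteq> \<zero>\<^bsub>A (\<c>\<^bsub>G\<^esub> t)\<^esub>}),
      monoid.one = (\<lambda>s\<in>Mor G. if s \<in> Obj G then \<one>\<^bsub>A s\<^esub> else \<zero>\<^bsub>A (\<c>\<^bsub>G\<^esub> s)\<^esub>),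
      ring.zero = (\<lambda>s\<in>Mor G. \<zero>\<^bsub>A (\<c>\<^bsub>G\<^esub> s)\<^esub>),
      ring.add = (\<lambda>f g. \<lambda>s\<in>Mor G. f s \<oplus>\<^bsub>A (\<c>\<^bsub>G\<^esub> s)\<^esub> g s) \<rparr>"

definition crossed_product_component ::
  "('m, 'x) category_scheme \<Rightarrow> ('m \<Rightarrow> 'a ring) \<Rightarrow> ('m \<Rightarrow> 'a \<Rightarrow> 'a) \<Rightarrow> ('m \<Rightarrow> 'm \<Rightarrow> 'a) \<Rightarrow> 'm \<Rightarrow> ('m \<Rightarrow> 'a) set"
where
  "crossed_product_component G A \<sigma> \<alpha> s =
    {f \<in> carrier (crossed_product G A \<sigma> \<alpha>). \<forall>t \<in> Mor G. t \<noteq> s \<longrightarrow> f t = \<zero>\<^bsub>A (\<c>\<^bsub>G\<^esub> t)\<^esub>}"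

definition graded_iso ::
  "('m, 'x) category_scheme \<Rightarrow> ('r, 'y) ring_scheme \<Rightarrow> ('m \<Rightarrow> 'r set) \<Rightarrow>
   ('q, 'z) ring_scheme \<Rightarrow> ('m \<Rightarrow> 'q set) \<Rightarrow> ('r \<Rightarrow> 'q) set"
where
  "graded_iso G R gr S gr' = {h \<in> ring_iso R S. \<forall>s \<in> Mor G. h ` gr s = gr' s}"

text \<open>The existential quantifier ranges over crossed systems whose coefficients have the
  same type as the elements of \<open>R\<close>. This is no restriction: see
  \<open>is_crossed_productI\<close> below, where the type of the coefficients is arbitrary.\<close>

definition is_crossed_product ::
  "('m, 'x) category_scheme \<Rightarrow> ('r, 'y) ring_scheme \<Rightarrow> ('m \<Rightarrow> 'r set) \<Rightarrow> bool"
where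
  "is_crossed_product G R gr \<longleftrightarrow>
    graded_ring G R gr \<and>
    (\<exists>(A :: 'm \<Rightarrow> 'r ring) \<sigma> \<alpha>. crossed_system G A \<sigma> \<alpha> \<and>
      graded_iso G R gr (crossed_product G A \<sigma> \<alpha>) (crossed_product_component G A \<sigma> \<alpha>) \<noteq> {})"

subsection \<open>Independence of the coefficient type\<close>

locale crossed_system_transport = crossed_system G A \<sigma> \<alpha>
  for G :: "('m, 'x) category_scheme" (structure)
    and A :: "'m \<Rightarrow> 'a ring" and \<sigma> :: "'m \<Rightarrow> 'a \<Rightarrow> 'a" and \<alpha> :: "'m \<Rightarrow> 'm \<Rightarrow> 'a" +
  fixes \<phi> :: "'m \<Rightarrow> 'a \<Rightarrow> 'b"
  assumes inj_\<phi>: "e \<in> Obj G \<Longrightarrow> inj_on (\<phi> e) (carrier (A e))"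
begin

definition "\<psi> e = inv_into (carrier (A e)) (\<phi> e)"
definition "B e = image_ring (\<phi> e) (A e)"
definition "\<tau> s = (\<lambda>b. \<phi> (\<c> s) (\<sigma> s (\<psi> (\<d> s) b)))"
definition "\<beta> s t = \<phi> (\<c> s) (\<alpha> s t)"
definition "\<Phi> f = (\<lambda>s\<in>Mor G. \<phi> (\<c> s) (f s))"

lemma obj_dom [simp]: "s \<in> Mor G \<Longrightarrow> \<d> s \<in> Obj G"
  by (simp add: Obj_def dom_closed dom_dom)

lemma obj_cod [simp]: "s \<in> Mor G \<Longrightarrow> \<c> s \<in> Obj G"
  by (simp add: Obj_def cod_closed dom_cod)

lemma obj_mor: "e \<in> Obj G \<Longrightarrow> e \<in> Mor G"
  by (simp add: Obj_def)

lemma dom_obj [simp]: "e \<in> Obj G \<Longrightarrow> \<d> e = e"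
  by (simp add: Obj_def)

lemma cod_obj [simp]: "e \<in> Obj G \<Longrightarrow> \<c> e = e"
  using cod_dom[OF obj_mor] by (metis dom_obj)

lemma composableD:
  assumes "(s, t) \<in> composable G"
  shows "s \<in> Mor G" "t \<in> Mor G" "\<d> s = \<c> t" "s \<bullet> t \<in> Mor G" "\<d> (s \<bullet> t) = \<d> t" "\<c> (s \<bullet> t) = \<c> s"
  using assms comp_closed dom_comp cod_comp by (auto simp: composable_def)

lemma composable_assoc:
  assumes "(s, t) \<in> composable G" "(t, r) \<in> composable G"
  shows "(s \<bullet> t, r) \<in> composable G" "(s, t \<bullet> r) \<in> composable G"
  using assms composableD[OF assms(1)] composableD[OF assms(2)] by (auto simp: composable_def)

lemma \<psi>_\<phi> [simp]: "\<lbrakk>e \<in> Obj G; a \<in> carrier (A e)\<rbrakk> \<Longrightarrow> \<psi> e (\<phi> e a) = a"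
  by (simp add: \<psi>_def inj_\<phi>)

lemma carrier_B: "carrier (B e) = \<phi> e ` carrier (A e)"
  by (simp add: B_def image_ring_carrier)

lemma \<phi>_iso: "e \<in> Obj G \<Longrightarrow> \<phi> e \<in> ring_iso (A e) (B e)"
  unfolding B_def by (rule inj_imp_image_ring_iso[OF inj_\<phi>])

lemma \<phi>_hom: "e \<in> Obj G \<Longrightarrow> \<phi> e \<in> ring_hom (A e) (B e)"
  using \<phi>_iso by (simp add: ring_iso_def)

lemma zero_B: "\<zero>\<^bsub>B e\<^esub> = \<phi> e \<zero>\<^bsub>A e\<^esub>"
  by (simp add: B_def image_ring_zero)

lemma one_B: "\<one>\<^bsub>B e\<^esub> = \<phi> e \<one>\<^bsub>A e\<^esub>"
  by (simp add: B_def image_ring_one)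

lemma ring_A': "e \<in> Obj G \<Longrightarrow> ring (A e)"
  using ring_A nonzero_ring.axioms(1) by blast

lemma ring_B: "e \<in> Obj G \<Longrightarrow> ring (B e)"
  unfolding B_def by (rule ring.inj_imp_image_ring_is_ring[OF ring_A' inj_\<phi>])

lemma \<phi>_eq_zero [simp]:
  "\<lbrakk>e \<in> Obj G; a \<in> carrier (A e)\<rbrakk> \<Longrightarrow> \<phi> e a = \<zero>\<^bsub>B e\<^esub> \<longleftrightarrow> a = \<zero>\<^bsub>A e\<^esub>"
  unfolding zero_B using inj_\<phi> ring_A' ring.ring_simprules(2) by (metis inj_on_eq_iff)

lemma nonzero_ring_B: "e \<in> Obj G \<Longrightarrow> nonzero_ring (B e)"
  unfolding nonzero_ring_def nonzero_ring_axioms_def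
  using ring_A[of e] ring_A'[of e] ring.ring_simprules(6)[OF ring_A'[of e]]
  by (simp add: ring_B one_B nonzero_ring_def nonzero_ring_axioms_def)

lemma \<sigma>_closed: "\<lbrakk>s \<in> Mor G; a \<in> carrier (A (\<d> s))\<rbrakk> \<Longrightarrow> \<sigma> s a \<in> carrier (A (\<c> s))"
  using \<sigma>_hom ring_hom_closed by metis

lemma \<tau>_\<phi>: "\<lbrakk>s \<in> Mor G; a \<in> carrier (A (\<d> s))\<rbrakk> \<Longrightarrow> \<tau> s (\<phi> (\<d> s) a) = \<phi> (\<c> s) (\<sigma> s a)"
  by (simp add: \<tau>_def)

lemma \<phi>_mult:
  "\<lbrakk>e \<in> Obj G; a \<in> carrier (A e); b \<in> carrier (A e)\<rbrakk> \<Longrightarrow>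
    \<phi> e a \<otimes>\<^bsub>B e\<^esub> \<phi> e b = \<phi> e (a \<otimes>\<^bsub>A e\<^esub> b)"
  using ring_hom_mult[OF \<phi>_hom] by metis

lemma \<phi>_add:
  "\<lbrakk>e \<in> Obj G; a \<in> carrier (A e); b \<in> carrier (A e)\<rbrakk> \<Longrightarrow>
    \<phi> e a \<oplus>\<^bsub>B e\<^esub> \<phi> e b = \<phi> e (a \<oplus>\<^bsub>A e\<^esub> b)"
  using ring_hom_add[OF \<phi>_hom] by metis

lemma crossed_system_B: "crossed_system G B \<tau> \<beta>"
proof (intro crossed_system.intro crossed_system_axioms.intro)
  show "category G" by (rule category_axioms)
next
  fix s assume s: "s \<in> Mor G"
  have "\<psi> (\<d> s) \<in> ring_hom (B (\<d> s)) (A (\<d> s))"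
    using ring_iso_set_sym[OF ring_A' \<phi>_iso] s by (simp add: \<psi>_def ring_iso_def)
  then have "\<phi> (\<c> s) \<circ> (\<sigma> s \<circ> \<psi> (\<d> s)) \<in> ring_hom (B (\<d> s)) (B (\<c> s))"
    by (rule ring_hom_trans[OF ring_hom_trans[OF _ \<sigma>_hom[OF s]] \<phi>_hom[OF obj_cod[OF s]]])
  then show "\<tau> s \<in> ring_hom (B (\<d> s)) (B (\<c> s))"
    by (simp add: \<tau>_def comp_def)
  show "\<beta> s (\<d> s) = \<one>\<^bsub>B (\<c> s)\<^esub>" "\<beta> (\<c> s) s = \<one>\<^bsub>B (\<c> s)\<^esub>"
    using s by (simp_all add: \<beta>_def \<alpha>_dom \<alpha>_cod one_B cod_cod)
next
  fix s t r assume st: "(s, t) \<in> composable G" and tr: "(t, r) \<in> composable G"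
  note D = composableD[OF st] composableD[OF tr] composable_assoc[OF st tr]
  have "\<tau> s (\<beta> t r) = \<phi> (\<c> s) (\<sigma> s (\<alpha> t r))"
    using \<tau>_\<phi>[of s "\<alpha> t r"] \<alpha>_closed[OF tr] D by (simp add: \<beta>_def)
  then show "\<beta> s t \<otimes>\<^bsub>B (\<c> s)\<^esub> \<beta> (s \<bullet> t) r = \<tau> s (\<beta> t r) \<otimes>\<^bsub>B (\<c> s)\<^esub> \<beta> s (t \<bullet> r)"
    using D \<alpha>_closed[OF st] \<alpha>_closed[OF tr] \<alpha>_closed[OF D(13)] \<alpha>_closed[OF D(14)]
      \<sigma>_closed[of s "\<alpha> t r"] cocycle[OF st tr]
    by (simp add: \<beta>_def \<phi>_mult)
next
  fix s t b assume st: "(s, t) \<in> composable G" and "b \<in> carrier (B (\<d> t))"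
  then obtain a where a: "a \<in> carrier (A (\<d> t))" "b = \<phi> (\<d> t) a"
    by (auto simp: carrier_B)
  note D = composableD[OF st]
  have 1: "\<tau> t b = \<phi> (\<d> s) (\<sigma> t a)" and 2: "\<tau> (s \<bullet> t) b = \<phi> (\<c> s) (\<sigma> (s \<bullet> t) a)"
    using \<tau>_\<phi>[of t a] \<tau>_\<phi>[of "s \<bullet> t" a] a D by simp_all
  have "\<tau> s (\<tau> t b) = \<phi> (\<c> s) (\<sigma> s (\<sigma> t a))"
    unfolding 1 using D \<sigma>_closed[of t a] a by (intro \<tau>_\<phi>) auto
  then show "\<tau> s (\<tau> t b) \<otimes>\<^bsub>B (\<c> s)\<^esub> \<beta> s t = \<beta> s t \<otimes>\<^bsub>B (\<c> s)\<^esub> \<tau> (s \<bullet> t) b"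
    using D a \<sigma>_closed[of t a] \<sigma>_closed[of s "\<sigma> t a"] \<sigma>_closed[of "s \<bullet> t" a] \<alpha>_closed[OF st]
      twisted_action[OF st a(1)]
    unfolding 2 \<beta>_def by (simp add: \<phi>_mult)
next
  fix s t assume "(s, t) \<in> composable G"
  then show "\<beta> s t \<in> carrier (B (\<c> s))"
    by (simp add: \<beta>_def carrier_B \<alpha>_closed)
next
  fix e b assume e: "e \<in> Obj G" and "b \<in> carrier (B e)"
  then obtain a where a: "a \<in> carrier (A e)" "b = \<phi> e a"
    by (auto simp: carrier_B)
  then show "\<tau> e b = b"
    using e unfolding \<tau>_def by (simp only: dom_obj cod_obj \<psi>_\<phi> \<sigma>_id)
next
  show "nonzero_ring (B e)" if "e \<in> Obj G" for e
    by (rule nonzero_ring_B[OF that])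
qed

lemma crossed_product_sel:
  fixes A' :: "'m \<Rightarrow> 'c ring"
  shows
  "carrier (crossed_product G A' \<sigma>' \<alpha>') =
    {f \<in> (\<Pi>\<^sub>E s\<in>Mor G. carrier (A' (\<c> s))). finite {s \<in> Mor G. f s \<noteq> \<zero>\<^bsub>A' (\<c> s)\<^esub>}}"
  "f \<otimes>\<^bsub>crossed_product G A' \<sigma>' \<alpha>'\<^esub> g = (\<lambda>r\<in>Mor G.
     finsum (A' (\<c> r)) (\<lambda>(s, t). f s \<otimes>\<^bsub>A' (\<c> r)\<^esub> \<sigma>' s (g t) \<otimes>\<^bsub>A' (\<c> r)\<^esub> \<alpha>' s t)
       {(s, t) \<in> composable G. s \<bullet> t = r \<and> f s \<noteq> \<zero>\<^bsub>A' (\<c> s)\<^esub> \<and> g t \<noteq> \<zero>\<^bsub>A' (\<c> t)\<^esub>})"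
  "f \<oplus>\<^bsub>crossed_product G A' \<sigma>' \<alpha>'\<^esub> g = (\<lambda>s\<in>Mor G. f s \<oplus>\<^bsub>A' (\<c> s)\<^esub> g s)"
  "\<one>\<^bsub>crossed_product G A' \<sigma>' \<alpha>'\<^esub> = (\<lambda>s\<in>Mor G. if s \<in> Obj G then \<one>\<^bsub>A' s\<^esub> else \<zero>\<^bsub>A' (\<c> s)\<^esub>)"
  by (simp_all add: crossed_product_def)

lemma \<Phi>_app: "s \<in> Mor G \<Longrightarrow> \<Phi> f s = \<phi> (\<c> s) (f s)"
  by (simp add: \<Phi>_def)

lemma coeff: "\<lbrakk>f \<in> carrier (crossed_product G A \<sigma> \<alpha>); s \<in> Mor G\<rbrakk> \<Longrightarrow> f s \<in> carrier (A (\<c> s))"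
  by (auto simp: crossed_product_sel)

lemma \<Phi>_zero: "\<lbrakk>f \<in> carrier (crossed_product G A \<sigma> \<alpha>); s \<in> Mor G\<rbrakk> \<Longrightarrow>
    \<Phi> f s = \<zero>\<^bsub>B (\<c> s)\<^esub> \<longleftrightarrow> f s = \<zero>\<^bsub>A (\<c> s)\<^esub>"
  by (simp add: \<Phi>_app coeff)

lemma \<Phi>_closed:
  assumes f: "f \<in> carrier (crossed_product G A \<sigma> \<alpha>)"
  shows "\<Phi> f \<in> carrier (crossed_product G B \<tau> \<beta>)"
proof -
  have "{s \<in> Mor G. \<Phi> f s \<noteq> \<zero>\<^bsub>B (\<c> s)\<^esub>} = {s \<in> Mor G. f s \<noteq> \<zero>\<^bsub>A (\<c> s)\<^esub>}"
    using \<Phi>_zero[OF f] by auto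
  moreover have "\<Phi> f \<in> (\<Pi>\<^sub>E s\<in>Mor G. carrier (B (\<c> s)))"
    using coeff[OF f] by (auto simp: \<Phi>_def carrier_B)
  ultimately show ?thesis
    using f by (simp add: crossed_product_sel)
qed

lemma \<Phi>_bij: "bij_betw \<Phi> (carrier (crossed_product G A \<sigma> \<alpha>)) (carrier (crossed_product G B \<tau> \<beta>))"
proof (rule bij_betw_byWitness[where f' = "\<lambda>g. \<lambda>s\<in>Mor G. \<psi> (\<c> s) (g s)"])
  let ?P = "carrier (crossed_product G A \<sigma> \<alpha>)" and ?Q = "carrier (crossed_product G B \<tau> \<beta>)"
  show "\<Phi> ` ?P \<subseteq> ?Q" using \<Phi>_closed by blast
  show "\<forall>f\<in>?P. (\<lambda>s\<in>Mor G. \<psi> (\<c> s) (\<Phi> f s)) = f"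
  proof
    fix f assume f: "f \<in> ?P"
    then have "f \<in> extensional (Mor G)" by (auto simp: crossed_product_sel PiE_def)
    then show "(\<lambda>s\<in>Mor G. \<psi> (\<c> s) (\<Phi> f s)) = f"
      by (intro extensionalityI) (auto simp: \<Phi>_app coeff[OF f])
  qed
  have ex: "\<exists>a. a \<in> carrier (A (\<c> s)) \<and> g s = \<phi> (\<c> s) a" if "g \<in> ?Q" "s \<in> Mor G" for g s
  proof -
    have "g s \<in> carrier (B (\<c> s))" using that by (auto simp: crossed_product_sel)
    then show ?thesis by (auto simp: carrier_B)
  qed
  have \<psi>: "\<psi> (\<c> s) (g s) \<in> carrier (A (\<c> s))" "\<phi> (\<c> s) (\<psi> (\<c> s) (g s)) = g s"
    if "g \<in> ?Q" "s \<in> Mor G" for g s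
    using ex[OF that] that by auto
  show "\<forall>g\<in>?Q. \<Phi> (\<lambda>s\<in>Mor G. \<psi> (\<c> s) (g s)) = g"
  proof
    fix g assume g: "g \<in> ?Q"
    then have "g \<in> extensional (Mor G)" by (auto simp: crossed_product_sel PiE_def)
    then show "\<Phi> (\<lambda>s\<in>Mor G. \<psi> (\<c> s) (g s)) = g"
      by (intro extensionalityI[of _ "Mor G"]) (auto simp: \<Phi>_def \<psi>[OF g])
  qed
  show "(\<lambda>g. \<lambda>s\<in>Mor G. \<psi> (\<c> s) (g s)) ` ?Q \<subseteq> ?P"
  proof clarify
    fix g assume g: "g \<in> ?Q"
    have "\<psi> (\<c> s) (g s) = \<zero>\<^bsub>A (\<c> s)\<^esub> \<longleftrightarrow> g s = \<zero>\<^bsub>B (\<c> s)\<^esub>" if s: "s \<in> Mor G" for s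
      using \<phi>_eq_zero[OF obj_cod[OF s] \<psi>(1)[OF g s]] unfolding \<psi>(2)[OF g s] by simp
    then have "{s \<in> Mor G. \<psi> (\<c> s) (g s) \<noteq> \<zero>\<^bsub>A (\<c> s)\<^esub>} = {s \<in> Mor G. g s \<noteq> \<zero>\<^bsub>B (\<c> s)\<^esub>}"
      by blast
    moreover have "finite {s \<in> Mor G. g s \<noteq> \<zero>\<^bsub>B (\<c> s)\<^esub>}"
      using g by (auto simp: crossed_product_sel)
    moreover have "{s \<in> Mor G. (\<lambda>s\<in>Mor G. \<psi> (\<c> s) (g s)) s \<noteq> \<zero>\<^bsub>A (\<c> s)\<^esub>} =
        {s \<in> Mor G. \<psi> (\<c> s) (g s) \<noteq> \<zero>\<^bsub>A (\<c> s)\<^esub>}" by auto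
    ultimately show "(\<lambda>s\<in>Mor G. \<psi> (\<c> s) (g s)) \<in> ?P"
      using \<psi>[OF g] by (simp add: crossed_product_sel)
  qed
qed

lemma \<Phi>_iso:
  "\<Phi> \<in> graded_iso G (crossed_product G A \<sigma> \<alpha>) (crossed_product_component G A \<sigma> \<alpha>)
         (crossed_product G B \<tau> \<beta>) (crossed_product_component G B \<tau> \<beta>)"
proof -
  let ?P = "crossed_product G A \<sigma> \<alpha>" and ?Q = "crossed_product G B \<tau> \<beta>"
  have mult: "\<Phi> (f \<otimes>\<^bsub>?P\<^esub> g) = \<Phi> f \<otimes>\<^bsub>?Q\<^esub> \<Phi> g"
    if f: "f \<in> carrier ?P" and g: "g \<in> carrier ?P" for f g
  proof -
    have "\<Phi> (f \<otimes>\<^bsub>?P\<^esub> g) r = (\<Phi> f \<otimes>\<^bsub>?Q\<^esub> \<Phi> g) r" if r: "r \<in> Mor G" for r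
    proof -
      let ?e = "\<c> r"
      let ?S = "{(s, t) \<in> composable G. s \<bullet> t = r \<and> f s \<noteq> \<zero>\<^bsub>A (\<c> s)\<^esub> \<and> g t \<noteq> \<zero>\<^bsub>A (\<c> t)\<^esub>}"
      let ?T = "{(s, t) \<in> composable G. s \<bullet> t = r \<and> \<Phi> f s \<noteq> \<zero>\<^bsub>B (\<c> s)\<^esub> \<and> \<Phi> g t \<noteq> \<zero>\<^bsub>B (\<c> t)\<^esub>}"
      let ?a = "\<lambda>(s, t). f s \<otimes>\<^bsub>A ?e\<^esub> \<sigma> s (g t) \<otimes>\<^bsub>A ?e\<^esub> \<alpha> s t"
      let ?b = "\<lambda>(s, t). \<Phi> f s \<otimes>\<^bsub>B ?e\<^esub> \<tau> s (\<Phi> g t) \<otimes>\<^bsub>B ?e\<^esub> \<beta> s t"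
      interpret h: ring_hom_ring "A ?e" "B ?e" "\<phi> ?e"
        using ring_A' ring_B \<phi>_hom r by (intro ring_hom_ringI2) auto
      have ST: "?T = ?S"
        using \<Phi>_zero[OF f] \<Phi>_zero[OF g] by (auto simp: composable_def)
      have *: "?a p \<in> carrier (A ?e)" "\<phi> ?e (?a p) = ?b p" if "p \<in> ?S" for p
      proof -
        obtain s t where p: "p = (s, t)" by (cases p)
        then have st: "(s, t) \<in> composable G" and e: "\<c> s = ?e"
          using that composableD(6)[of s t] by auto
        note D = composableD[OF st]
        have [simp]: "f s \<in> carrier (A ?e)" "g t \<in> carrier (A (\<d> s))"
          "\<sigma> s (g t) \<in> carrier (A ?e)" "\<alpha> s t \<in> carrier (A ?e)"
          using coeff[OF f D(1)] coeff[OF g D(2)] \<sigma>_closed[OF D(1), of "g t"] \<alpha>_closed[OF st] D e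
          by simp_all
        have "\<tau> s (\<Phi> g t) = \<phi> ?e (\<sigma> s (g t))"
          using \<tau>_\<phi>[OF D(1), of "g t"] coeff[OF g D(2)] D e by (simp add: \<Phi>_app)
        then show "?a p \<in> carrier (A ?e)" "\<phi> ?e (?a p) = ?b p"
          using D e by (simp_all add: p \<Phi>_app \<beta>_def)
      qed
      have "\<Phi> (f \<otimes>\<^bsub>?P\<^esub> g) r = \<phi> ?e (finsum (A ?e) ?a ?S)"
        using r by (simp add: \<Phi>_app crossed_product_sel(2))
      also have "\<dots> = finsum (B ?e) (\<phi> ?e \<circ> ?a) ?S"
        using *(1) by (intro h.hom_finsum) blast
      also have "\<dots> = finsum (B ?e) ?b ?S"
      proof (rule h.S.finsum_cong'[OF refl])
        show "?b \<in> ?S \<rightarrow> carrier (B ?e)"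
        proof (rule Pi_I)
          fix p assume p: "p \<in> ?S"
          show "?b p \<in> carrier (B ?e)"
            unfolding *(2)[OF p, symmetric] by (rule h.hom_closed[OF *(1)[OF p]])
        qed
        show "(\<phi> ?e \<circ> ?a) p = ?b p" if "p \<in> ?S" for p
          unfolding comp_apply by (rule *(2)[OF that])
      qed
      finally show ?thesis
        using r by (simp add: crossed_product_sel(2) ST)
    qed
    then show ?thesis
      by (intro extensionalityI[of _ "Mor G"]) (simp_all add: \<Phi>_def crossed_product_sel(2))
  qed
  have add: "\<Phi> (f \<oplus>\<^bsub>?P\<^esub> g) = \<Phi> f \<oplus>\<^bsub>?Q\<^esub> \<Phi> g"
    if f: "f \<in> carrier ?P" and g: "g \<in> carrier ?P" for f g
    using coeff[OF f] coeff[OF g]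
    by (intro extensionalityI[of _ "Mor G"]) (simp_all add: \<Phi>_def crossed_product_sel(3) \<phi>_add)
  have one: "\<Phi> \<one>\<^bsub>?P\<^esub> = \<one>\<^bsub>?Q\<^esub>"
    by (intro extensionalityI[of _ "Mor G"])
      (simp_all add: \<Phi>_def crossed_product_sel(4) one_B zero_B)
  have "\<Phi> ` crossed_product_component G A \<sigma> \<alpha> s = crossed_product_component G B \<tau> \<beta> s" for s
  proof -
    have "\<Phi> ` {f \<in> carrier ?P. \<forall>t \<in> Mor G. t \<noteq> s \<longrightarrow> f t = \<zero>\<^bsub>A (\<c> t)\<^esub>} =
        \<Phi> ` {f \<in> carrier ?P. \<forall>t \<in> Mor G. t \<noteq> s \<longrightarrow> \<Phi> f t = \<zero>\<^bsub>B (\<c> t)\<^esub>}"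
      using \<Phi>_zero by (intro arg_cong[where f = "image \<Phi>"] Collect_cong) blast
    also have "\<dots> = {g \<in> \<Phi> ` carrier ?P. \<forall>t \<in> Mor G. t \<noteq> s \<longrightarrow> g t = \<zero>\<^bsub>B (\<c> t)\<^esub>}"
      by blast
    finally show ?thesis
      using \<Phi>_bij by (simp add: crossed_product_component_def bij_betw_def)
  qed
  moreover have "\<Phi> \<in> ring_iso ?P ?Q"
    by (rule ring_iso_memI[OF \<Phi>_closed mult add one \<Phi>_bij])
  ultimately show ?thesis
    by (simp add: graded_iso_def)
qed

end

lemma is_crossed_productI:
  fixes A :: "'m \<Rightarrow> 'a ring" and R :: "('r, 'y) ring_scheme"
  assumes gr_R: "graded_ring G R gr" and cs: "crossed_system G A \<sigma> \<alpha>"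
    and h: "h \<in> graded_iso G R gr (crossed_product G A \<sigma> \<alpha>) (crossed_product_component G A \<sigma> \<alpha>)"
  shows "is_crossed_product G R gr"
proof -
  interpret crossed_system G A \<sigma> \<alpha> by (rule cs)
  let ?P = "crossed_product G A \<sigma> \<alpha>"
  define \<iota> where "\<iota> e a = (\<lambda>s\<in>Mor G. if s = e then a else \<zero>\<^bsub>A (\<c>\<^bsub>G\<^esub> s)\<^esub>)" for e a
  define \<phi> where "\<phi> e a = inv_into (carrier R) h (\<iota> e a)" for e a
  have h': "h \<in> ring_iso R ?P" "\<And>s. s \<in> Mor G \<Longrightarrow> h ` gr s = crossed_product_component G A \<sigma> \<alpha> s"
    using h by (auto simp: graded_iso_def)
  have surj: "h ` carrier R = carrier ?P"
    using h' by (auto simp: ring_iso_def bij_betw_def)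
  have "inj_on (\<phi> e) (carrier (A e))" if e: "e \<in> Obj G" for e
  proof (rule inj_onI)
    have e': "e \<in> Mor G" "\<c>\<^bsub>G\<^esub> e = e" using e cod_dom[of e] by (auto simp: Obj_def)
    fix a b assume ab: "a \<in> carrier (A e)" "b \<in> carrier (A e)" "\<phi> e a = \<phi> e b"
    have mem: "\<iota> e x \<in> h ` carrier R" if "x \<in> carrier (A e)" for x
    proof -
      have "finite {s \<in> Mor G. \<iota> e x s \<noteq> \<zero>\<^bsub>A (\<c>\<^bsub>G\<^esub> s)\<^esub>}"
        by (rule finite_subset[of _ "{e}"]) (auto simp: \<iota>_def)
      moreover have "\<zero>\<^bsub>A (\<c>\<^bsub>G\<^esub> s)\<^esub> \<in> carrier (A (\<c>\<^bsub>G\<^esub> s))" if "s \<in> Mor G" for s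
      proof -
        have "\<c>\<^bsub>G\<^esub> s \<in> Obj G" using that by (simp add: Obj_def cod_closed dom_cod)
        then show ?thesis using ring_A nonzero_ring.axioms(1) ring.ring_simprules(2) by blast
      qed
      ultimately show ?thesis
        using that e' unfolding surj by (auto simp: crossed_product_def \<iota>_def)
    qed
    have "\<iota> e a = \<iota> e b"
      using ab mem by (metis \<phi>_def inv_into_injective)
    then have "\<iota> e a e = \<iota> e b e" by simp
    then show "a = b" using e' by (simp add: \<iota>_def)
  qed
  then interpret T: crossed_system_transport G A \<sigma> \<alpha> \<phi>
    by unfold_locales
  let ?Q = "crossed_product G T.B T.\<tau> T.\<beta>"
  have T: "T.\<Phi> \<in> ring_iso ?P ?Q"
    "\<And>s. s \<in> Mor G \<Longrightarrow>
      T.\<Phi> ` crossed_product_component G A \<sigma> \<alpha> s = crossed_product_component G T.B T.\<tau> T.\<beta> s"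
    using T.\<Phi>_iso by (auto simp: graded_iso_def)
  have "T.\<Phi> \<circ> h \<in> ring_iso R ?Q"
    by (rule ring_iso_set_trans[OF h'(1) T(1)])
  moreover have "(T.\<Phi> \<circ> h) ` gr s = crossed_product_component G T.B T.\<tau> T.\<beta> s" if "s \<in> Mor G" for s
    unfolding image_comp[symmetric] h'(2)[OF that] by (rule T(2)[OF that])
  ultimately have "T.\<Phi> \<circ> h \<in> graded_iso G R gr ?Q (crossed_product_component G T.B T.\<tau> T.\<beta>)"
    unfolding graded_iso_def by blast
  then show ?thesis
    using gr_R T.crossed_system_B unfolding is_crossed_product_def by blast
qed

end

theory Submission
  imports Defs "HOL-Library.Z2"
begin

text \<open>
  In a crossed product every component \<open>A\<^bsub>c(s)\<^esub> u\<^sub>s\<close> is a copy of the coefficient ring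
  \<open>A\<^bsub>c(s)\<^esub>\<close>, and so is the component of degree \<open>c(s)\<close>. In a finite ring that is a crossed
  product, the components of degree \<open>s\<close> and \<open>c(s)\<close> therefore have equally many elements
  (\<open>card_component_crossed_product\<close>). It suffices to find a finite strongly graded ring that
  violates this for one \<open>s\<close>.

  Such a ring consists of matrices over the field with two elements. Label the rows and columns
  \<open>i\<close> by morphisms \<open>\<gamma> i\<close>, and let the matrix unit at position \<open>(i, j)\<close> have degree
  \<open>\<gamma> i (\<gamma> j)\<inverse>\<close>; positions for which this quotient does not exist are left out. If every
  morphism occurs as a label, a matrix unit of degree \<open>st\<close> at \<open>(i, j)\<close> factors through an
  index labelled \<open>t \<gamma> j\<close>, so the grading is strong (\<open>strongly_graded_matrix_ring\<close>).

  Let \<open>s\<close> be a nonidentity morphism and \<open>e = c(s)\<close>, use \<open>e\<close> as a label twice and every other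
  morphism once, and let \<open>N\<close> be the number of morphisms with codomain \<open>e\<close>. With single labels
  both degrees have \<open>N\<close> positions. In degree \<open>e\<close> the second copy of \<open>e\<close> pairs with itself and,
  in either order, with the first copy, which gives \<open>N + 3\<close> positions. In degree \<open>s\<close> it can only
  pair with an index labelled \<open>s\<close> or \<open>s\<inverse>\<close>, because \<open>s \<noteq> e\<close>, which gives at most \<open>N + 2\<close>.
  The components have \<open>2\<close> to the power of these numbers elements, so they differ in size.
\<close>

section \<open>Matrix rings supported on a preorder\<close>

definition supported_on :: "'p set \<Rightarrow> ('p \<Rightarrow> 'k::zero) set" where
  "supported_on V = {f. \<forall>p. p \<notin> V \<longrightarrow> f p = 0}"

definition mat_mult :: "'i set \<Rightarrow> ('i \<times> 'i \<Rightarrow> 'k::semiring_0) \<Rightarrow> ('i \<times> 'i \<Rightarrow> 'k) \<Rightarrow> 'i \<times> 'i \<Rightarrow> 'k" where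
  "mat_mult I f g = (\<lambda>(i, j). \<Sum>k\<in>I. f (i, k) * g (k, j))"

text \<open>The carrier is closed under multiplication if \<open>U\<close> is transitive and contains the identity
  matrix if \<open>U\<close> is reflexive on \<open>I\<close>: this is the incidence algebra of the preorder \<open>U\<close>.\<close>

definition matrix_ring :: "'i set \<Rightarrow> ('i \<times> 'i) set \<Rightarrow> ('i \<times> 'i \<Rightarrow> 'k::ring_1) ring" where
  "matrix_ring I U =
    \<lparr> carrier = supported_on U,
      monoid.mult = mat_mult I,
      monoid.one = (\<lambda>(i, j). if i = j \<and> i \<in> I then 1 else 0),
      ring.zero = (\<lambda>_. 0),
      ring.add = (\<lambda>f g p. f p + g p) \<rparr>"

lemma matrix_ring_sel [simp]:
  "carrier (matrix_ring I U) = supported_on U"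
  "f \<otimes>\<^bsub>matrix_ring I U\<^esub> g = mat_mult I f g"
  "\<one>\<^bsub>matrix_ring I U\<^esub> = (\<lambda>(i, j). if i = j \<and> i \<in> I then 1 else 0)"
  "\<zero>\<^bsub>matrix_ring I U\<^esub> = (\<lambda>_. 0)"
  "f \<oplus>\<^bsub>matrix_ring I U\<^esub> g = (\<lambda>p. f p + g p)"
  by (simp_all add: matrix_ring_def)

lemma supported_onD: "f \<in> supported_on V \<Longrightarrow> p \<notin> V \<Longrightarrow> f p = 0"
  by (simp add: supported_on_def)

lemma supported_on_mono: "V \<subseteq> W \<Longrightarrow> supported_on V \<subseteq> supported_on W"
  by (auto simp: supported_on_def)

lemma supported_on_empty: "supported_on {} = {\<lambda>_. 0}"
  by (auto simp: supported_on_def)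

lemma mat_mult_supported_on:
  assumes "f \<in> supported_on V" "g \<in> supported_on W"
  shows "mat_mult I f g \<in> supported_on (V O W)"
proof -
  have "f (i, k) * g (k, j) = 0" if "(i, j) \<notin> V O W" for i j k
    using that supported_onD[OF assms(1), of "(i, k)"] supported_onD[OF assms(2), of "(k, j)"]
    by (cases "(i, k) \<in> V") (auto simp: relcomp_unfold)
  then show ?thesis
    by (auto simp: supported_on_def mat_mult_def intro!: sum.neutral)
qed

lemma card_supported_on:
  assumes "finite V"
  shows "card (supported_on V :: ('p \<Rightarrow> bit) set) = 2 ^ card V"
proof -
  have "bij_betw (\<lambda>f. {p. f p = 1}) (supported_on V :: ('p \<Rightarrow> bit) set) (Pow V)"
    by (rule bij_betw_byWitness[where f' = "\<lambda>P p. of_bool (p \<in> P)"])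
      (auto simp: supported_on_def fun_eq_iff of_bool_def)
  then show ?thesis
    using assms by (simp add: bij_betw_same_card card_Pow)
qed

locale preorder_matrices =
  fixes I :: "'i set" and U :: "('i \<times> 'i) set"
  assumes finite_I: "finite I"
    and U_sub: "U \<subseteq> I \<times> I"
    and U_refl: "i \<in> I \<Longrightarrow> (i, i) \<in> U"
    and U_trans: "U O U \<subseteq> U"
begin

lemma finite_U: "finite U"
  using finite_I U_sub by (meson finite_SigmaI finite_subset)

lemma ring_matrix_ring: "ring (matrix_ring I U :: ('i \<times> 'i \<Rightarrow> 'k::ring_1) ring)"
proof (rule ringI)
  let ?R = "matrix_ring I U :: ('i \<times> 'i \<Rightarrow> 'k) ring"
  show "abelian_group ?R"
  proof (rule abelian_groupI)
    fix f :: "'i \<times> 'i \<Rightarrow> 'k" assume "f \<in> carrier ?R"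
    then show "\<exists>g\<in>carrier ?R. g \<oplus>\<^bsub>?R\<^esub> f = \<zero>\<^bsub>?R\<^esub>"
      by (intro bexI[of _ "\<lambda>p. - f p"]) (auto simp: supported_on_def)
  qed (auto simp: supported_on_def add_ac)
  have one: "mat_mult I \<one>\<^bsub>?R\<^esub> f = f" "mat_mult I f \<one>\<^bsub>?R\<^esub> = f" if f: "f \<in> supported_on U" for f
  proof -
    have outside: "f (i, j) = 0" if "i \<notin> I \<or> j \<notin> I" for i j
      using supported_onD[OF f] U_sub that by blast
    have "(\<Sum>k\<in>I. (if i = k \<and> i \<in> I then 1 else 0) * f (k, j)) = f (i, j)" for i j
    proof -
      have "(\<Sum>k\<in>I. (if i = k \<and> i \<in> I then 1 else 0) * f (k, j)) = (\<Sum>k\<in>I. if i = k then f (k, j) else 0)"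
        by (rule sum.cong) auto
      also have "\<dots> = f (i, j)" using finite_I outside by (simp add: sum.delta)
      finally show ?thesis .
    qed
    moreover have "(\<Sum>k\<in>I. f (i, k) * (if k = j \<and> k \<in> I then 1 else 0)) = f (i, j)" for i j
    proof -
      have "(\<Sum>k\<in>I. f (i, k) * (if k = j \<and> k \<in> I then 1 else 0)) = (\<Sum>k\<in>I. if k = j then f (i, k) else 0)"
        by (rule sum.cong) auto
      also have "\<dots> = f (i, j)" using finite_I outside by (simp add: sum.delta)
      finally show ?thesis .
    qed
    ultimately show "mat_mult I \<one>\<^bsub>?R\<^esub> f = f" "mat_mult I f \<one>\<^bsub>?R\<^esub> = f"
      by (auto simp: mat_mult_def fun_eq_iff)
  qed
  show "monoid ?R"
  proof (rule monoidI)
    fix f g h :: "'i \<times> 'i \<Rightarrow> 'k"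
    show "f \<otimes>\<^bsub>?R\<^esub> g \<in> carrier ?R" if "f \<in> carrier ?R" "g \<in> carrier ?R"
      using mat_mult_supported_on[of f U g U] that supported_on_mono[OF U_trans] by auto
    have "(\<Sum>l\<in>I. (\<Sum>k\<in>I. f (i, k) * g (k, l)) * h (l, j)) =
        (\<Sum>k\<in>I. f (i, k) * (\<Sum>l\<in>I. g (k, l) * h (l, j)))" for i j
      unfolding sum_distrib_left sum_distrib_right
      by (subst sum.swap) (simp add: mult.assoc)
    then show "f \<otimes>\<^bsub>?R\<^esub> g \<otimes>\<^bsub>?R\<^esub> h = f \<otimes>\<^bsub>?R\<^esub> (g \<otimes>\<^bsub>?R\<^esub> h)"
      by (auto simp: mat_mult_def fun_eq_iff)
    show "\<one>\<^bsub>?R\<^esub> \<in> carrier ?R"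
      using U_refl by (auto simp: supported_on_def)
    show "\<one>\<^bsub>?R\<^esub> \<otimes>\<^bsub>?R\<^esub> f = f" "f \<otimes>\<^bsub>?R\<^esub> \<one>\<^bsub>?R\<^esub> = f" if "f \<in> carrier ?R"
      using one that by auto
  qed
qed (auto simp: mat_mult_def fun_eq_iff algebra_simps sum.distrib)

lemma finsum_matrix_ring:
  fixes F :: "'a \<Rightarrow> 'i \<times> 'i \<Rightarrow> 'k::ring_1"
  assumes "finite A" "\<And>a. a \<in> A \<Longrightarrow> F a \<in> supported_on U"
  shows "finsum (matrix_ring I U) F A = (\<lambda>p. \<Sum>a\<in>A. F a p)"
proof -
  interpret ring "matrix_ring I U :: ('i \<times> 'i \<Rightarrow> 'k) ring" by (rule ring_matrix_ring)
  show ?thesis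
    using assms
  proof (induction A)
    case empty
    then show ?case by simp
  next
    case (insert a A)
    then show ?case by (subst finsum_insert) (auto simp: fun_eq_iff)
  qed
qed

lemma additive_subgroup_supported_on:
  assumes "V \<subseteq> U"
  shows "additive_subgroup (supported_on V) (matrix_ring I U :: ('i \<times> 'i \<Rightarrow> 'k::ring_1) ring)"
proof -
  let ?R = "matrix_ring I U :: ('i \<times> 'i \<Rightarrow> 'k) ring"
  interpret ring ?R by (rule ring_matrix_ring)
  have neg: "\<ominus>\<^bsub>?R\<^esub> f = (\<lambda>p. - f p)" if "f \<in> supported_on U" for f
    using that by (intro minus_equality) (auto simp: supported_on_def)
  show ?thesis
  proof (rule additive_subgroupI[OF add.subgroupI])
    show "supported_on V \<subseteq> carrier ?R"
      using supported_on_mono[OF assms] by auto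
    show "\<ominus>\<^bsub>?R\<^esub> f \<in> supported_on V" if "f \<in> supported_on V" for f
    proof -
      have "f \<in> supported_on U" using that supported_on_mono[OF assms] by blast
      then show ?thesis using that by (simp add: neg supported_on_def)
    qed
  qed (auto simp: supported_on_def)
qed

text \<open>A matrix supported on \<open>V O W\<close> is a sum of multiples of matrix units, and the unit at
  \<open>(i, j)\<close> is the product of the units at \<open>(i, k)\<close> and \<open>(k, j)\<close> for an intermediate index \<open>k\<close>.
  This reduces all multiplicative conditions on a grading by sets of positions to conditions on
  relational composition.\<close>

lemma add_span_mult_supported_on:
  assumes V: "V \<subseteq> U" and W: "W \<subseteq> U"
  shows "add_span_mult (matrix_ring I U :: ('i \<times> 'i \<Rightarrow> 'k::ring_1) ring) (supported_on V) (supported_on W)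
    = supported_on (V O W)"
proof
  let ?R = "matrix_ring I U :: ('i \<times> 'i \<Rightarrow> 'k) ring"
  let ?P = "supported_on V <#>\<^bsub>?R\<^esub> supported_on W"
  interpret ring ?R by (rule ring_matrix_ring)
  have VW: "V O W \<subseteq> U" using V W U_trans by blast
  have "?P \<subseteq> supported_on (V O W)"
    by (auto simp: set_mult_def mat_mult_supported_on)
  then show "add_span_mult ?R (supported_on V) (supported_on W) \<subseteq> supported_on (V O W)"
    unfolding add_span_mult_def
    using add.generate_subgroup_incl additive_subgroup.a_subgroup[OF additive_subgroup_supported_on[OF VW]]
    by blast
  have "f \<in> generate (add_monoid ?R) ?P" if "finite Z" "Z \<subseteq> V O W" "f \<in> supported_on Z" for f Z
    using that
  proof (induction Z arbitrary: f)
    case empty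
    then have "f = \<one>\<^bsub>add_monoid ?R\<^esub>" by (simp add: supported_on_empty)
    then show ?case by (simp only: generate.one)
  next
    case (insert p Z)
    then obtain i k j where p: "p = (i, j)" "(i, k) \<in> V" "(k, j) \<in> W" by auto
    then have k: "k \<in> I" using V U_sub by auto
    define a b :: "'i \<times> 'i \<Rightarrow> 'k"
      where "a = (\<lambda>q. if q = (i, k) then f p else 0)" and "b = (\<lambda>q. if q = (k, j) then 1 else 0)"
    have "mat_mult I a b (i', j') = (if (i', j') = p then f p else 0)" for i' j'
    proof -
      have "mat_mult I a b (i', j') = (\<Sum>l\<in>I. if l = k then (if (i', j') = p then f p else 0) else 0)"
        unfolding mat_mult_def a_def b_def p(1) by (auto intro!: sum.cong)
      then show ?thesis using k finite_I by (simp add: sum.delta)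
    qed
    then have ab: "mat_mult I a b = (\<lambda>q. if q = p then f p else 0)" by (auto simp: fun_eq_iff)
    have "a \<in> supported_on V" "b \<in> supported_on W"
      using p by (auto simp: a_def b_def supported_on_def)
    then have "mat_mult I a b \<in> ?P"
      by (auto simp: set_mult_def)
    then have "mat_mult I a b \<in> generate (add_monoid ?R) ?P" by (rule generate.incl)
    moreover have "f(p := 0) \<in> generate (add_monoid ?R) ?P"
      using insert by (intro insert.IH) (auto simp: supported_on_def)
    ultimately have "mat_mult I a b \<otimes>\<^bsub>add_monoid ?R\<^esub> f(p := 0) \<in> generate (add_monoid ?R) ?P"
      by (rule generate.eng)
    moreover have "mat_mult I a b \<otimes>\<^bsub>add_monoid ?R\<^esub> f(p := 0) = f"
      by (auto simp: ab fun_eq_iff)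
    ultimately show ?case by (simp only:)
  qed
  then show "supported_on (V O W) \<subseteq> add_span_mult ?R (supported_on V) (supported_on W)"
    unfolding add_span_mult_def using finite_subset[OF VW finite_U] by blast
qed

end

section \<open>Gradings of matrix rings by a partition of the positions\<close>

text \<open>The axioms of a strong grading, transferred from components to the sets \<open>D s\<close> of
  positions of degree \<open>s\<close>. The equation in \<open>D_comp\<close>, rather than an inclusion, is what makes
  the grading strong.\<close>

locale graded_positions = category G
  for G :: "('m, 'x) category_scheme" (structure) and I :: "'i set" and D :: "'m \<Rightarrow> ('i \<times> 'i) set" +
  assumes fin_I: "finite I" and I_nonempty: "I \<noteq> {}"
    and fin_Mor: "finite (Mor G)"
    and D_sub: "s \<in> Mor G \<Longrightarrow> D s \<subseteq> I \<times> I"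
    and D_disjoint: "\<lbrakk>s \<in> Mor G; t \<in> Mor G; p \<in> D s; p \<in> D t\<rbrakk> \<Longrightarrow> s = t"
    and D_refl: "i \<in> I \<Longrightarrow> \<exists>s\<in>Mor G. (i, i) \<in> D s"
    and D_comp: "(s, t) \<in> composable G \<Longrightarrow> D s O D t = D (s \<bullet> t)"
    and D_comp_empty: "\<lbrakk>s \<in> Mor G; t \<in> Mor G; (s, t) \<notin> composable G\<rbrakk> \<Longrightarrow> D s O D t = {}"
begin

definition "U = (\<Union>s\<in>Mor G. D s)"

lemma D_sub_U: "s \<in> Mor G \<Longrightarrow> D s \<subseteq> U"
  by (auto simp: U_def)

sublocale preorder_matrices I U
proof
  show "U O U \<subseteq> U"
  proof
    fix p assume "p \<in> U O U"
    then obtain s t where st: "s \<in> Mor G" "t \<in> Mor G" "p \<in> D s O D t" by (fastforce simp: U_def)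
    then have "(s, t) \<in> composable G" using D_comp_empty by blast
    then show "p \<in> U" using st D_comp comp_closed by (auto simp: U_def)
  qed
qed (use fin_I D_sub D_refl in \<open>auto simp: U_def\<close>)

text \<open>The homogeneous component of a matrix in degree \<open>s\<close> is its restriction to the positions in
  \<open>D s\<close>; as these sets partition \<open>U\<close>, the decomposition is unique.\<close>

theorem strongly_graded_matrix_ring:
  "strongly_graded_ring G (matrix_ring I U :: ('i \<times> 'i \<Rightarrow> 'k::ring_1) ring) (\<lambda>s. supported_on (D s))"
proof -
  let ?R = "matrix_ring I U :: ('i \<times> 'i \<Rightarrow> 'k) ring"
  let ?gr = "\<lambda>s. supported_on (D s) :: ('i \<times> 'i \<Rightarrow> 'k) set"
  interpret ring ?R by (rule ring_matrix_ring)
  have one: "\<one>\<^bsub>?R\<^esub> \<noteq> \<zero>\<^bsub>?R\<^esub>"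
  proof -
    obtain i where "i \<in> I" using I_nonempty by blast
    then have "\<one>\<^bsub>?R\<^esub> (i, i) \<noteq> \<zero>\<^bsub>?R\<^esub> (i, i)" by simp
    then show ?thesis by metis
  qed
  have direct: "\<exists>!F. F \<in> (\<Pi>\<^sub>E s\<in>Mor G. ?gr s) \<and> finite {s \<in> Mor G. F s \<noteq> \<zero>\<^bsub>?R\<^esub>} \<and>
      f = (\<Oplus>\<^bsub>?R\<^esub>s \<in> {s \<in> Mor G. F s \<noteq> \<zero>\<^bsub>?R\<^esub>}. F s)" if f: "f \<in> carrier ?R" for f
  proof -
    have sum: "(\<Oplus>\<^bsub>?R\<^esub>s \<in> {s \<in> Mor G. F s \<noteq> \<zero>\<^bsub>?R\<^esub>}. F s) = (\<lambda>p. \<Sum>s\<in>Mor G. F s p)"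
      if F: "F \<in> (\<Pi>\<^sub>E s\<in>Mor G. ?gr s)" for F
    proof -
      have "F s \<in> supported_on U" if "s \<in> Mor G" for s
        using F that supported_on_mono[OF D_sub_U[OF that]] by blast
      then have "(\<Oplus>\<^bsub>?R\<^esub>s \<in> {s \<in> Mor G. F s \<noteq> \<zero>\<^bsub>?R\<^esub>}. F s) =
          (\<lambda>p. \<Sum>s\<in>{s \<in> Mor G. F s \<noteq> \<zero>\<^bsub>?R\<^esub>}. F s p)"
        using fin_Mor by (intro finsum_matrix_ring) auto
      also have "\<dots> = (\<lambda>p. \<Sum>s\<in>Mor G. F s p)"
        using fin_Mor by (intro ext sum.mono_neutral_left) auto
      finally show ?thesis .
    qed
    \<comment> \<open>At a position of degree \<open>t\<close> all summands of other degrees vanish, which determines \<open>F\<close>.\<close>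
    have at: "(\<Sum>s\<in>Mor G. F s p) = F t p"
      if F: "F \<in> (\<Pi>\<^sub>E s\<in>Mor G. ?gr s)" and t: "t \<in> Mor G" "p \<in> D t" for F t p
    proof -
      have "F s p = (if s = t then F t p else 0)" if s: "s \<in> Mor G" for s
      proof -
        have "F s \<in> ?gr s" using F s by blast
        then show ?thesis using D_disjoint[OF s t(1) _ t(2)] supported_onD[of "F s" "D s" p] by auto
      qed
      then have "(\<Sum>s\<in>Mor G. F s p) = (\<Sum>s\<in>Mor G. if s = t then F t p else 0)"
        by (intro sum.cong) auto
      then show ?thesis using fin_Mor t by (simp add: sum.delta)
    qed
    define F where "F = (\<lambda>s\<in>Mor G. \<lambda>p. if p \<in> D s then f p else 0)"
    have F: "F \<in> (\<Pi>\<^sub>E s\<in>Mor G. ?gr s)" by (auto simp: F_def supported_on_def)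
    have "f p = (\<Sum>s\<in>Mor G. F s p)" for p
    proof (cases "p \<in> U")
      case True
      then obtain t where "t \<in> Mor G" "p \<in> D t" by (auto simp: U_def)
      then show ?thesis using at[OF F] by (simp add: F_def)
    next
      case False
      then have "f p = 0" using f supported_onD by fastforce
      then show ?thesis by (simp add: F_def cong: if_cong)
    qed
    then have "f = (\<lambda>p. \<Sum>s\<in>Mor G. F s p)" by (rule ext)
    moreover have "F' = F" if F': "F' \<in> (\<Pi>\<^sub>E s\<in>Mor G. ?gr s)" "f = (\<lambda>p. \<Sum>s\<in>Mor G. F' s p)" for F'
    proof (rule PiE_ext[OF F'(1) F])
      fix s assume s: "s \<in> Mor G"
      have "F' s \<in> ?gr s" using F' s by blast
      then have "F' s p = F s p" for p
        using at[OF F'(1) s, of p] fun_cong[OF F'(2), of p] supported_onD[of "F' s" "D s" p] s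
        by (cases "p \<in> D s") (simp_all add: F_def)
      then show "F' s = F s" by blast
    qed
    moreover have fin: "finite {s \<in> Mor G. P s}" for P
      using fin_Mor by simp
    ultimately show ?thesis
      using F sum fin by (intro ex1I[of _ F]) (simp_all only: simp_thms)
  qed
  have mult: "add_span_mult ?R (?gr s) (?gr t) = ?gr (s \<bullet> t)" if "(s, t) \<in> composable G" for s t
    using that add_span_mult_supported_on[OF D_sub_U D_sub_U, of s t] D_comp[OF that]
    by (auto simp: composable_def)
  have mult_zero: "add_span_mult ?R (?gr s) (?gr t) = {\<zero>\<^bsub>?R\<^esub>}"
    if "s \<in> Mor G" "t \<in> Mor G" "(s, t) \<notin> composable G" for s t
    using that add_span_mult_supported_on[OF D_sub_U D_sub_U, of s t] D_comp_empty[OF that]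
    by (simp add: supported_on_empty)
  show ?thesis
    by (intro strongly_graded_ring.intro graded_ring.intro graded_ring_axioms.intro
        strongly_graded_ring_axioms.intro nonzero_ring.intro nonzero_ring_axioms.intro
        category_axioms ring_axioms one direct mult_zero
        additive_subgroup_supported_on[OF D_sub_U]) (simp_all only: mult subset_refl not_False_eq_True)
qed

end

section \<open>Strong gradings under a change of the underlying set\<close>

text \<open>Through an injection into another type, a finite ring can be moved to the natural numbers
  together with its grading.\<close>

lemma strongly_graded_image_ring:
  assumes "strongly_graded_ring G R gr" and inj: "inj_on h (carrier R)"
  shows "strongly_graded_ring G (image_ring h R) (\<lambda>s. h ` gr s)"
proof -
  interpret strongly_graded_ring G R gr by fact
  let ?S = "image_ring h R"
  interpret S: ring ?S by (rule R.inj_imp_image_ring_is_ring[OF inj])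
  have iso: "h \<in> ring_iso R ?S" by (rule inj_imp_image_ring_iso[OF inj])
  interpret h: ring_hom_ring R ?S h
    using iso by (intro ring_hom_ringI2) (auto simp: ring_iso_def R.ring_axioms S.ring_axioms)
  have gr_sub: "gr s \<subseteq> carrier R" if "s \<in> Mor G" for s
    using gr_subgroup[OF that] by (rule additive_subgroup.a_subset)
  have zero_iff: "h x = \<zero>\<^bsub>?S\<^esub> \<longleftrightarrow> x = \<zero>\<^bsub>R\<^esub>" if "x \<in> carrier R" for x
    unfolding image_ring_zero by (rule inj_on_eq_iff[OF inj that R.zero_closed])
  have span: "add_span_mult ?S (h ` gr s) (h ` gr t) = h ` add_span_mult R (gr s) (gr t)"
    if "s \<in> Mor G" "t \<in> Mor G" for s t
  proof -
    have sub: "gr s <#>\<^bsub>R\<^esub> gr t \<subseteq> carrier R"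
      using gr_sub that by (auto simp: set_mult_def intro!: R.m_closed)
    have "h ` gr s <#>\<^bsub>?S\<^esub> h ` gr t = h ` (gr s <#>\<^bsub>R\<^esub> gr t)"
      using gr_sub that unfolding set_mult_def
      by (fastforce simp: subset_iff image_iff)
    then show ?thesis
      using group_hom.generate_img[OF h.a_group_hom] sub by (simp add: add_span_mult_def)
  qed
  have subgr: "additive_subgroup (h ` gr s) ?S" if "s \<in> Mor G" for s
    using group_hom.subgroup_img_is_subgroup[OF h.a_group_hom]
      additive_subgroup.a_subgroup[OF gr_subgroup[OF that]]
    by (auto intro: additive_subgroupI)
  have direct: "\<exists>!f. f \<in> (\<Pi>\<^sub>E s\<in>Mor G. h ` gr s) \<and> finite {s \<in> Mor G. f s \<noteq> \<zero>\<^bsub>?S\<^esub>} \<and>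
      y = (\<Oplus>\<^bsub>?S\<^esub>s \<in> {s \<in> Mor G. f s \<noteq> \<zero>\<^bsub>?S\<^esub>}. f s)" if y: "y \<in> carrier ?S" for y
  proof -
    obtain x where x: "x \<in> carrier R" "y = h x"
      using y by (auto simp: image_ring_carrier)
    let ?dec = "\<lambda>f. f \<in> (\<Pi>\<^sub>E s\<in>Mor G. gr s) \<and> finite {s \<in> Mor G. f s \<noteq> \<zero>\<^bsub>R\<^esub>} \<and>
           x = (\<Oplus>\<^bsub>R\<^esub>s \<in> {s \<in> Mor G. f s \<noteq> \<zero>\<^bsub>R\<^esub>}. f s)"
    let ?Dec = "\<lambda>f. f \<in> (\<Pi>\<^sub>E s\<in>Mor G. h ` gr s) \<and> finite {s \<in> Mor G. f s \<noteq> \<zero>\<^bsub>?S\<^esub>} \<and>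
           y = (\<Oplus>\<^bsub>?S\<^esub>s \<in> {s \<in> Mor G. f s \<noteq> \<zero>\<^bsub>?S\<^esub>}. f s)"
    have ex: "\<exists>!f. ?dec f" using direct_sum[OF x(1)] .
    \<comment> \<open>Decompositions of \<open>y = h x\<close> are exactly the images under \<open>h\<close> of those of \<open>x\<close>.\<close>
    have push: "?Dec (\<lambda>s\<in>Mor G. h (f s)) \<longleftrightarrow> ?dec f" if f: "f \<in> (\<Pi>\<^sub>E s\<in>Mor G. gr s)" for f
    proof -
      have fc: "f s \<in> carrier R" if "s \<in> Mor G" for s using f gr_sub that by blast
      let ?A = "{s \<in> Mor G. f s \<noteq> \<zero>\<^bsub>R\<^esub>}"
      have A: "{s \<in> Mor G. (\<lambda>s\<in>Mor G. h (f s)) s \<noteq> \<zero>\<^bsub>?S\<^esub>} = ?A"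
        using fc zero_iff by auto
      have "(\<Oplus>\<^bsub>?S\<^esub>s \<in> ?A. (\<lambda>s\<in>Mor G. h (f s)) s) = (\<Oplus>\<^bsub>?S\<^esub>s \<in> ?A. (h \<circ> f) s)"
        using fc by (intro S.finsum_cong') auto
      also have "\<dots> = h (\<Oplus>\<^bsub>R\<^esub>s \<in> ?A. f s)"
        using h.hom_finsum[of f ?A] fc by (auto simp: comp_def)
      finally have "y = (\<Oplus>\<^bsub>?S\<^esub>s \<in> ?A. (\<lambda>s\<in>Mor G. h (f s)) s) \<longleftrightarrow> h x = h (\<Oplus>\<^bsub>R\<^esub>s \<in> ?A. f s)"
        using x by simp
      also have "\<dots> \<longleftrightarrow> x = (\<Oplus>\<^bsub>R\<^esub>s \<in> ?A. f s)"
        using x fc by (intro inj_on_eq_iff[OF inj] R.finsum_closed) auto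
      finally show ?thesis
        unfolding A using f by auto
    qed
    have lift: "\<exists>f. f \<in> (\<Pi>\<^sub>E s\<in>Mor G. gr s) \<and> g = (\<lambda>s\<in>Mor G. h (f s))"
      if g: "g \<in> (\<Pi>\<^sub>E s\<in>Mor G. h ` gr s)" for g
    proof -
      have "\<forall>s\<in>Mor G. \<exists>a. a \<in> gr s \<and> g s = h a" using g by blast
      then obtain f where "\<forall>s\<in>Mor G. f s \<in> gr s \<and> g s = h (f s)" by metis
      then show ?thesis
        using g by (intro exI[of _ "restrict f (Mor G)"])
          (auto intro!: extensionalityI[of _ "Mor G"] simp: PiE_def)
    qed
    from ex obtain f where f: "?dec f" "\<And>f'. ?dec f' \<Longrightarrow> f' = f" by blast
    show ?thesis
    proof (rule ex1I[of _ "\<lambda>s\<in>Mor G. h (f s)"])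
      show "?Dec (\<lambda>s\<in>Mor G. h (f s))" using push f(1) by blast
      show "g = (\<lambda>s\<in>Mor G. h (f s))" if "?Dec g" for g
      proof -
        obtain f' where f': "f' \<in> (\<Pi>\<^sub>E s\<in>Mor G. gr s)" "g = (\<lambda>s\<in>Mor G. h (f' s))"
          using lift \<open>?Dec g\<close> by blast
        then have "f' = f" using push[OF f'(1)] \<open>?Dec g\<close> f(2) by blast
        then show ?thesis using f'(2) by simp
      qed
    qed
  qed
  have eq: "add_span_mult ?S (h ` gr s) (h ` gr t) = h ` gr (s \<bullet>\<^bsub>G\<^esub> t)"
    if "(s, t) \<in> composable G" for s t
    using that span[of s t] gr_mult_eq[OF that] by (simp add: composable_def)
  have zero: "add_span_mult ?S (h ` gr s) (h ` gr t) = {\<zero>\<^bsub>?S\<^esub>}"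
    if "s \<in> Mor G" "t \<in> Mor G" "(s, t) \<notin> composable G" for s t
    using that span[of s t] gr_mult_zero[OF that] by simp
  have one: "\<one>\<^bsub>?S\<^esub> \<noteq> \<zero>\<^bsub>?S\<^esub>"
    using zero_iff[of "\<one>\<^bsub>R\<^esub>"] R.one_neq_zero by simp
  show ?thesis
    by (intro strongly_graded_ring.intro graded_ring.intro graded_ring_axioms.intro
        strongly_graded_ring_axioms.intro nonzero_ring.intro nonzero_ring_axioms.intro
        G.category_axioms S.ring_axioms one subgr direct zero) (simp_all add: eq)
qed

section \<open>Components of a crossed product\<close>

lemma (in crossed_system) component_bij_coefficients:
  assumes s: "s \<in> Mor G"
  shows "bij_betw (\<lambda>f. f s) (crossed_product_component G A \<sigma> \<alpha> s) (carrier (A (\<c> s)))"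
proof -
  have zero: "\<zero>\<^bsub>A (\<c> t)\<^esub> \<in> carrier (A (\<c> t))" if "t \<in> Mor G" for t
  proof -
    have "\<c> t \<in> Obj G" using that by (simp add: Obj_def cod_closed dom_cod)
    then show ?thesis using ring_A nonzero_ring.axioms(1) ring.ring_simprules(2) by blast
  qed
  have fin: "finite {t \<in> Mor G. (\<lambda>t\<in>Mor G. if t = s then a else \<zero>\<^bsub>A (\<c> t)\<^esub>) t \<noteq> \<zero>\<^bsub>A (\<c> t)\<^esub>}" for a
    by (rule finite_subset[of _ "{s}"]) auto
  show ?thesis
    by (rule bij_betw_byWitness[where f' = "\<lambda>a. \<lambda>t\<in>Mor G. if t = s then a else \<zero>\<^bsub>A (\<c> t)\<^esub>"])
      (use s zero fin in \<open>auto simp: crossed_product_component_def crossed_product_def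
        PiE_def intro!: extensionalityI[of _ "Mor G"] split: if_splits\<close>)
qed

text \<open>The components of degree \<open>s\<close> and \<open>c(s)\<close> are both in bijection with the coefficient ring at
  \<open>c(s)\<close>. This is the obstruction to being a crossed product.\<close>

lemma card_component_crossed_product:
  assumes "is_crossed_product G R gr" and s: "s \<in> Mor G"
  shows "card (gr s) = card (gr (\<c>\<^bsub>G\<^esub> s))"
proof -
  obtain A :: "'a \<Rightarrow> 'c ring" and \<sigma> \<alpha> h where cs: "crossed_system G A \<sigma> \<alpha>"
    and h: "h \<in> graded_iso G R gr (crossed_product G A \<sigma> \<alpha>) (crossed_product_component G A \<sigma> \<alpha>)"
    and gr: "graded_ring G R gr"
    using assms unfolding is_crossed_product_def by blast
  interpret crossed_system G A \<sigma> \<alpha> by (rule cs)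
  interpret graded_ring G R gr by (rule gr)
  have "card (gr t) = card (carrier (A (\<c>\<^bsub>G\<^esub> t)))" if t: "t \<in> Mor G" for t
  proof -
    have "inj_on h (carrier R)" and im: "h ` gr t = crossed_product_component G A \<sigma> \<alpha> t"
      using h t by (auto simp: graded_iso_def ring_iso_def bij_betw_def)
    then have "inj_on h (gr t)"
      using additive_subgroup.a_subset[OF gr_subgroup[OF t]] inj_on_subset by blast
    then have "card (gr t) = card (crossed_product_component G A \<sigma> \<alpha> t)"
      using card_image im by metis
    then show ?thesis
      using bij_betw_same_card[OF component_bij_coefficients[OF t]] by simp
  qed
  then show ?thesis
    using s cod_closed cod_cod by simp
qed

section \<open>Elementary gradings over a groupoid\<close>

text \<open>Rows and columns are labelled by morphisms, and position \<open>(i, j)\<close> has degree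
  \<open>\<gamma> i (\<gamma> j)\<inverse>\<close>. In \<open>positions\<close> the inverse is moved to the other side of the equation;
  cancellation in the groupoid then makes the degree unique. Since all morphisms occur as labels,
  an intermediate index with the label \<open>t \<gamma> j\<close> always exists.\<close>

locale elementary_grading = groupoid G
  for G :: "('m, 'x) category_scheme" (structure) and I :: "'i set" and \<gamma> :: "'i \<Rightarrow> 'm" +
  assumes finite_index: "finite I" and index_nonempty: "I \<noteq> {}"
    and \<gamma>_onto: "\<gamma> ` I = Mor G"
begin

definition positions :: "'m \<Rightarrow> ('i \<times> 'i) set" where
  "positions s = {(i, j) \<in> I \<times> I. (s, \<gamma> j) \<in> composable G \<and> \<gamma> i = s \<bullet> \<gamma> j}"

lemma composable_assoc:
  assumes "(s, t) \<in> composable G" "(t, r) \<in> composable G"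
  shows "(s \<bullet> t, r) \<in> composable G" "(s, t \<bullet> r) \<in> composable G"
  using assms comp_closed dom_comp cod_comp by (auto simp: composable_def)

lemma right_cancel:
  assumes "(s, g) \<in> composable G" "(t, g) \<in> composable G" "s \<bullet> g = t \<bullet> g"
  shows "s = t"
proof -
  have mor: "g \<in> Mor G" "s \<in> Mor G" "t \<in> Mor G" "\<d> s = \<c> g" "\<d> t = \<c> g"
    using assms by (auto simp: composable_def)
  obtain k where k: "k \<in> Mor G" "\<c> k = \<d> g" "g \<bullet> k = \<c> g"
    using invertible[OF mor(1)] by blast
  have gk: "(g, k) \<in> composable G" using mor k by (simp add: composable_def)
  have "s = s \<bullet> (g \<bullet> k)" using comp_dom mor k by metis
  also have "\<dots> = t \<bullet> (g \<bullet> k)" using comp_assoc[OF _ gk] assms by metis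
  also have "\<dots> = t" using comp_dom mor k by metis
  finally show ?thesis .
qed

sublocale graded_positions G I positions
proof
  show "finite I" "I \<noteq> {}" by (rule finite_index, rule index_nonempty)
  show "finite (Mor G)" using finite_index \<gamma>_onto by (metis finite_imageI)
  show "positions s \<subseteq> I \<times> I" for s by (auto simp: positions_def)
  show "s = t" if "p \<in> positions s" "p \<in> positions t" for p s t
    using that right_cancel by (auto simp: positions_def)
  show "\<exists>s\<in>Mor G. (i, i) \<in> positions s" if i: "i \<in> I" for i
  proof -
    have "\<gamma> i \<in> Mor G" using i \<gamma>_onto by blast
    then show ?thesis
      using i cod_closed dom_cod cod_comp_self
      by (intro bexI[of _ "\<c> (\<gamma> i)"]) (auto simp: positions_def composable_def)
  qed
  show "positions s O positions t = {}" if "s \<in> Mor G" "t \<in> Mor G" "(s, t) \<notin> composable G" for s t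
  proof -
    have "(s, t) \<in> composable G" if "(i, k) \<in> positions s" "(k, j) \<in> positions t" for i j k
      using that cod_comp[of t "\<gamma> j"] by (auto simp: positions_def composable_def)
    then show ?thesis using that(3) by blast
  qed
  show "positions s O positions t = positions (s \<bullet> t)" if st: "(s, t) \<in> composable G" for s t
  proof
    show "positions s O positions t \<subseteq> positions (s \<bullet> t)"
      using st comp_assoc[OF st] composable_assoc[OF st] by (auto simp: positions_def)
    show "positions (s \<bullet> t) \<subseteq> positions s O positions t"
    proof clarify
      fix i j assume ij: "(i, j) \<in> positions (s \<bullet> t)"
      then have tj: "(t, \<gamma> j) \<in> composable G" and "i \<in> I" "j \<in> I"
        using st dom_comp[OF st] by (auto simp: positions_def composable_def)
      moreover obtain k where k: "k \<in> I" "\<gamma> k = t \<bullet> \<gamma> j"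
        using comp_closed[OF tj] \<gamma>_onto by force
      ultimately show "(i, j) \<in> positions s O positions t"
        using ij comp_assoc[OF st tj] composable_assoc[OF st tj]
        by (intro relcompI[of _ k]) (auto simp: positions_def)
    qed
  qed
qed

end

section \<open>Doubling one identity morphism\<close>

text \<open>The index \<open>None\<close> is the second copy of \<open>e\<close>. The two counts of positions show that degree
  \<open>e\<close> has strictly more positions than degree \<open>s\<close>.\<close>

theorem theorem5:
  fixes G :: "('m, 'x) category_scheme"
  assumes "groupoid G"
    and "finite (Mor G)"
    and "\<exists>s \<in> Mor G. s \<notin> Obj G"
  shows "\<exists>(R :: nat ring) gr. strongly_graded_ring G R gr \<and> \<not> is_crossed_product G R gr"
proof -
  interpret groupoid G by fact
  obtain s where s: "s \<in> Mor G" "s \<notin> Obj G" using assms(3) by blast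
  define e where "e = \<c>\<^bsub>G\<^esub> s"
  have e: "e \<in> Mor G" "\<d>\<^bsub>G\<^esub> e = e" "\<c>\<^bsub>G\<^esub> e = e"
    using s by (auto simp: e_def cod_closed dom_cod cod_cod)
  define I :: "'m option set" where "I = insert None (Some ` Mor G)"
  define \<gamma> where "\<gamma> = case_option e id"
  interpret elementary_grading G I \<gamma>
    by unfold_locales (use assms(2) e in \<open>auto simp: I_def \<gamma>_def image_iff\<close>)
  have [simp]: "\<gamma> None = e" "\<gamma> (Some g) = g" "None \<in> I" "Some g \<in> I \<longleftrightarrow> g \<in> Mor G" for g
    by (auto simp: \<gamma>_def I_def)
  let ?N = "{g \<in> Mor G. \<c>\<^bsub>G\<^esub> g = e}"
  have fin_positions: "finite (positions t)" if "t \<in> Mor G" for t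
    using finite_subset[OF D_sub_U[OF that] finite_U] .
  have upper: "card (positions s) \<le> card ?N + 2"
  proof -
    obtain t where t: "t \<in> Mor G" "\<d>\<^bsub>G\<^esub> t = \<c>\<^bsub>G\<^esub> s" "\<c>\<^bsub>G\<^esub> t = \<d>\<^bsub>G\<^esub> s" "t \<bullet>\<^bsub>G\<^esub> s = \<d>\<^bsub>G\<^esub> s"
      using invertible[OF s(1)] by blast
    have inv: "t \<bullet>\<^bsub>G\<^esub> (s \<bullet>\<^bsub>G\<^esub> g) = g" if g: "(s, g) \<in> composable G" for g
    proof -
      have "(t, s) \<in> composable G" using s t by (simp add: composable_def)
      then have "t \<bullet>\<^bsub>G\<^esub> (s \<bullet>\<^bsub>G\<^esub> g) = \<d>\<^bsub>G\<^esub> s \<bullet>\<^bsub>G\<^esub> g"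
        using comp_assoc g t by metis
      then show ?thesis using g cod_comp_self by (auto simp: composable_def)
    qed
    \<comment> \<open>Here \<open>t\<close> is the inverse of \<open>s\<close>, and \<open>t \<bullet> e = t\<close>: the first extra position has its column
      labelled by the inverse of \<open>s\<close>. The second one has degree \<open>s\<close> only if \<open>s\<close> is an
      endomorphism.\<close>
    let ?F = "\<lambda>g. (Some g, Some (t \<bullet>\<^bsub>G\<^esub> g))"
    have "positions s \<subseteq> ?F ` ?N \<union> {(None, Some (t \<bullet>\<^bsub>G\<^esub> e)), (Some s, None)}"
    proof (rule subrelI, rule UnCI)
      fix i j assume ij: "(i, j) \<in> positions s" "(i, j) \<notin> {(None, Some (t \<bullet>\<^bsub>G\<^esub> e)), (Some s, None)}"
      then have c: "(s, \<gamma> j) \<in> composable G" and eq: "\<gamma> i = s \<bullet>\<^bsub>G\<^esub> \<gamma> j" by (auto simp: positions_def)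
      have tj: "t \<bullet>\<^bsub>G\<^esub> \<gamma> i = \<gamma> j" using inv[OF c] eq by simp
      have i_cod: "\<gamma> i \<in> ?N" using cod_comp[OF c] comp_closed[OF c] eq by (simp add: e_def)
      show "(i, j) \<in> ?F ` ?N"
      proof (cases j)
        case None
        then have "\<gamma> i = s" using c eq e comp_dom[OF s(1)] by (auto simp: composable_def)
        moreover have "s \<noteq> e" using s e by (auto simp: Obj_def)
        \<comment> \<open>If \<open>i = None\<close> then \<open>s = e\<close>; otherwise \<open>(i, j)\<close> is the second extra position.\<close>
        ultimately show ?thesis using ij None by (cases i) auto
      next
        case (Some g)
        then show ?thesis using ij tj i_cod by (cases i) auto
      qed
    qed
    then have "card (positions s) \<le> card (?F ` ?N \<union> {(None, Some (t \<bullet>\<^bsub>G\<^esub> e)), (Some s, None)})"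
      using assms(2) by (intro card_mono) auto
    also have "\<dots> \<le> card (?F ` ?N) + card {(None, Some (t \<bullet>\<^bsub>G\<^esub> e)), (Some s, None)}"
      by (rule card_Un_le)
    also have "\<dots> \<le> card ?N + 2"
      using assms(2) by (intro add_mono card_image_le) auto
    finally show ?thesis .
  qed
  have lower: "card ?N + 3 \<le> card (positions e)"
  proof -
    let ?F = "\<lambda>g. (Some g, Some g)" and ?E = "{(None, None), (None, Some e), (Some e, None)}"
    have "card (?F ` ?N \<union> ?E) = card (?F ` ?N) + card ?E"
      using assms(2) by (intro card_Un_disjoint) auto
    moreover have "card (?F ` ?N) = card ?N"
      by (rule card_image) (auto simp: inj_on_def)
    moreover have "?F ` ?N \<union> ?E \<subseteq> positions e"
      using e cod_comp_self comp_dom[OF e(1)] by (auto simp: positions_def composable_def)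
    ultimately show ?thesis
      using card_mono[OF fin_positions[OF e(1)], of "?F ` ?N \<union> ?E"] by simp
  qed
  let ?R = "matrix_ring I U :: ('m option \<times> 'm option \<Rightarrow> bit) ring"
  let ?gr = "\<lambda>s. supported_on (positions s) :: ('m option \<times> 'm option \<Rightarrow> bit) set"
  have "card (supported_on U :: ('m option \<times> 'm option \<Rightarrow> bit) set) \<noteq> 0"
    by (simp add: card_supported_on finite_U)
  then have "finite (carrier ?R)"
    by (metis card.infinite matrix_ring_sel(1))
  then obtain h :: "_ \<Rightarrow> nat" where h: "inj_on h (carrier ?R)"
    using finite_imp_inj_to_nat_seg by metis
  have card_gr: "card (h ` ?gr t) = 2 ^ card (positions t)" if "t \<in> Mor G" for t
  proof -
    have "?gr t \<subseteq> carrier ?R" using supported_on_mono[OF D_sub_U[OF that]] by simp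
    then have "card (h ` ?gr t) = card (?gr t)" using h by (intro card_image) (rule inj_on_subset)
    then show ?thesis using card_supported_on[OF fin_positions[OF that]] by simp
  qed
  have "\<not> is_crossed_product G (image_ring h ?R) (\<lambda>s. h ` ?gr s)"
  proof
    assume "is_crossed_product G (image_ring h ?R) (\<lambda>s. h ` ?gr s)"
    from card_component_crossed_product[OF this s(1)] have "card (positions s) = card (positions e)"
      using card_gr[OF s(1)] card_gr[OF e(1)] by (simp add: e_def)
    then show False using upper lower by simp
  qed
  then show ?thesis
    using strongly_graded_image_ring[OF strongly_graded_matrix_ring h] by blast
qed

end
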